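(* Let $G$ be a finite nonabelian group and let $\psi\in\mathrm{Ab}(G)$. Then for all integers $m,n\ge 0$, the following maps $G\times G\to G\times G$ are (non-degenerate, set-theoretic) solutions to the Yang-Baxter equation on the set $G$: \begin{align*} R_{m,n}(g,h)&=\Big(\psi_m(g)\psi_n(g^{-1})h\psi_n(g)\psi_m(g^{-1}),\ \psi_m(g)\psi_n(g^{-1}h)h^{-1}\psi_n(g)\psi_m(g^{-1})g\psi_n(g^{-1})h\psi_n(gh^{-1})\Big),\\ R_{m,n}'(g,h)&=\Big(g\psi_n(g^{-1})h\psi_n(g)\psi_m(h^{-1})g^{-1}\psi_m(h),\ \psi_n(h)\psi_m(h^{-1})g\psi_m(h)\psi_n(h^{-1})\Big). \end{align*}
   Context: $G$ is written multiplicatively, with identity $1_G$. $\mathrm{Ab}(G)$ is the set of abelian maps, i.e., group endomorphisms $\psi:G\to G$ whose image $\psi(G)$ is abelian. $\mathrm{Map}(G)$ is the set of all functions $G\to G$, with operations $(\phi+\chi)(g)=\phi(g)\chi(g)$, $(-\phi)(g)=\phi(g)^{-1}$, $\phi-\chi=\phi+(-\chi)$, and product $(\phi\chi)(g)=\phi(\chi(g))$; $1$ denotes the identity map, and $\phi^n$ the $n$-fold composite ($\phi^0=1$). For $\psi\in\mathrm{Ab}(G)$ and $n\ge 0$, $\psi_n=-(1-\psi)^n+1\in\mathrm{Map}(G)$, i.e. $\psi_n(g)=\big((1-\psi)^n(g)\big)^{-1}g$, where $(1-\psi)(g)=g\psi(g)^{-1}$. A set-theoretic solution to the Yang-Baxter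 equation on a set $B$ is a function $R:B\times B\to B\times B$ such that $(R\times\mathrm{id})(\mathrm{id}\times R)(R\times\mathrm{id})=(\mathrm{id}\times R)(R\times\mathrm{id})(\mathrm{id}\times R)$ as maps $B\times B\times B\to B\times B\times B$. Writing $R(x,y)=(f_x(y),g_y(x))$, the solution $R$ is non-degenerate if $f_x:B\to B$ and $g_y:B\to B$ are invertible for all $x,y\in B$. "Solution" means non-degenerate set-theoretic solution. *)

theory Defs
  imports "HOL-Algebra.Algebra"
begin

definition abelian_maps :: "('a, 'b) monoid_scheme \<Rightarrow> ('a \<Rightarrow> 'a) set" where
  "abelian_maps G = {\<psi> \<in> hom G G. comm_group (G\<lparr>carrier := \<psi> ` carrier G\<rparr>)}"

(* The set of all self-maps of G: multiplication is composition, its unit is id,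
   and powers are iterates (^^). Values outside the carrier are irrelevant. *)

definition map_add :: "('a, 'b) monoid_scheme \<Rightarrow> ('a \<Rightarrow> 'a) \<Rightarrow> ('a \<Rightarrow> 'a) \<Rightarrow> 'a \<Rightarrow> 'a" where
  "map_add G \<phi> \<chi> = (\<lambda>g. \<phi> g \<otimes>\<^bsub>G\<^esub> \<chi> g)"

definition map_neg :: "('a, 'b) monoid_scheme \<Rightarrow> ('a \<Rightarrow> 'a) \<Rightarrow> 'a \<Rightarrow> 'a" where
  "map_neg G \<phi> = (\<lambda>g. inv\<^bsub>G\<^esub> (\<phi> g))"

definition map_diff :: "('a, 'b) monoid_scheme \<Rightarrow> ('a \<Rightarrow> 'a) \<Rightarrow> ('a \<Rightarrow> 'a) \<Rightarrow> 'a \<Rightarrow> 'a" where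
  "map_diff G \<phi> \<chi> = map_add G \<phi> (map_neg G \<chi>)"

(* psi_n = -(1 - psi)^n + 1; the addition is not commutative, so the order matters. *)
definition psi_iter :: "('a, 'b) monoid_scheme \<Rightarrow> ('a \<Rightarrow> 'a) \<Rightarrow> nat \<Rightarrow> 'a \<Rightarrow> 'a" where
  "psi_iter G \<psi> n = map_add G (map_neg G ((map_diff G id \<psi>) ^^ n)) id"

(* R x id and id x R on triples, which are nested to the right *)
definition map_left :: "('a \<times> 'a \<Rightarrow> 'a \<times> 'a) \<Rightarrow> 'a \<times> 'a \<times> 'a \<Rightarrow> 'a \<times> 'a \<times> 'a" where
  "map_left R = (\<lambda>(x, y, z). (fst (R (x, y)), snd (R (x, y)), z))"

definition map_right :: "('a \<times> 'a \<Rightarrow> 'a \<times> 'a) \<Rightarrow> 'a \<times> 'a \<times> 'a \<Rightarrow> 'a \<times> 'a \<times> 'a" where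
  "map_right R = map_prod id R"

definition set_theoretic_YBE_solution :: "'a set \<Rightarrow> ('a \<times> 'a \<Rightarrow> 'a \<times> 'a) \<Rightarrow> bool" where
  "set_theoretic_YBE_solution B R \<longleftrightarrow>
     R \<in> B \<times> B \<rightarrow> B \<times> B \<and>
     (\<forall>t \<in> B \<times> B \<times> B.
        (map_left R \<circ> map_right R \<circ> map_left R) t =
        (map_right R \<circ> map_left R \<circ> map_right R) t)"

(* R (x, y) = (f_x y, g_y x) *)
definition non_degenerate :: "'a set \<Rightarrow> ('a \<times> 'a \<Rightarrow> 'a \<times> 'a) \<Rightarrow> bool" where
  "non_degenerate B R \<longleftrightarrow>
     (\<forall>x\<in>B. bij_betw (\<lambda>y. fst (R (x, y))) B B) \<and>
     (\<forall>y\<in>B. bij_betw (\<lambda>x. snd (R (x, y))) B B)"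

definition YBE_solution :: "'a set \<Rightarrow> ('a \<times> 'a \<Rightarrow> 'a \<times> 'a) \<Rightarrow> bool" where
  "YBE_solution B R \<longleftrightarrow> set_theoretic_YBE_solution B R \<and> non_degenerate B R"

end

theory Submission
  imports Defs
begin

text \<open>
  Every abelian map \<open>\<phi>\<close> twists the group law into a group law
  \<open>g \<circ>\<^sub>\<phi> h = g \<phi>(g)\<^sup>-\<^sup>1 h \<phi>(g)\<close>. Each \<open>\<psi>\<^sub>k\<close> is an endomorphism with values in the abelian
  group \<open>\<psi>(G)\<close>, and because the values of \<open>\<psi>\<^sub>m\<close> and \<open>\<psi>\<^sub>n\<close> commute with each other, the twisted
  laws of \<open>\<psi>\<^sub>m\<close> (additive) and \<open>\<psi>\<^sub>n\<close> (circle) form a skew brace. The standard solution of a skew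
  brace, \<open>(x, y) \<mapsto> (\<lambda>\<^sub>x(y), \<lambda>\<^sub>x(y)\<^sup>-\<^sup>1 \<circ> x \<circ> y)\<close> with \<open>\<lambda>\<^sub>x(y) = -x + (x \<circ> y)\<close>, is \<open>R\<^sub>m\<^sub>,\<^sub>n\<close>; the
  solution of the brace with the opposite additive group is \<open>R'\<^sub>m\<^sub>,\<^sub>n\<close>.
\<close>

section \<open>Skew braces and their solutions of the Yang-Baxter equation\<close>

locale skew_brace = add: group A + circ: group C 
  for A :: "('a, 'b) monoid_scheme" (structure) and C :: "('a, 'c) monoid_scheme" +
  assumes carrier_eq: "carrier C = carrier A"
    and brace: "\<lbrakk>x \<in> carrier A; y \<in> carrier A; z \<in> carrier A\<rbrakk> \<Longrightarrow>
      x \<otimes>\<^bsub>C\<^esub> (y \<otimes> z) = (x \<otimes>\<^bsub>C\<^esub> y) \<otimes> inv x \<otimes> (x \<otimes>\<^bsub>C\<^esub> z)"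
begin

lemmas circ_closed [simp, intro] = circ.m_closed[unfolded carrier_eq]
lemmas circ_inv_closed [simp, intro] = circ.inv_closed[unfolded carrier_eq]
lemmas circ_assoc = circ.m_assoc[unfolded carrier_eq]

definition lam :: "'a \<Rightarrow> 'a \<Rightarrow> 'a" where
  "lam x y = inv x \<otimes> (x \<otimes>\<^bsub>C\<^esub> y)"

definition rho :: "'a \<Rightarrow> 'a \<Rightarrow> 'a" where
  "rho y x = inv\<^bsub>C\<^esub> (lam x y) \<otimes>\<^bsub>C\<^esub> (x \<otimes>\<^bsub>C\<^esub> y)"

lemma lam_closed [simp, intro]: "\<lbrakk>x \<in> carrier A; y \<in> carrier A\<rbrakk> \<Longrightarrow> lam x y \<in> carrier A"
  by (simp add: lam_def)

lemma rho_closed [simp, intro]: "\<lbrakk>x \<in> carrier A; y \<in> carrier A\<rbrakk> \<Longrightarrow> rho y x \<in> carrier A"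
  by (simp add: rho_def)

text \<open>With the identity e of \<open>C\<close> in the first slot and \<one> in the others, the
  brace law collapses to \<one> = \<open>inv e\<close>.\<close>

lemma circ_one_eq: "\<one>\<^bsub>C\<^esub> = \<one>"
proof -
  have e: "\<one>\<^bsub>C\<^esub> \<in> carrier A"
    using circ.one_closed carrier_eq by simp
  have "\<one> = inv \<one>\<^bsub>C\<^esub>"
    using brace[of "\<one>\<^bsub>C\<^esub>" \<one> \<one>] e by (simp add: carrier_eq)
  then show ?thesis
    using e by (metis add.inv_inv add.inv_one)
qed

lemmas circ_one [simp] =
  circ.l_one[unfolded circ_one_eq carrier_eq] circ.r_one[unfolded circ_one_eq carrier_eq]

lemma circ_eq: "\<lbrakk>x \<in> carrier A; y \<in> carrier A\<rbrakk> \<Longrightarrow> x \<otimes>\<^bsub>C\<^esub> y = x \<otimes> lam x y"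
  by (simp add: lam_def flip: add.m_assoc)

lemma lam_one_left: "y \<in> carrier A \<Longrightarrow> lam \<one> y = y"
  by (simp add: lam_def)

lemma lam_one_right: "x \<in> carrier A \<Longrightarrow> lam x \<one> = \<one>"
  by (simp add: lam_def)

text \<open>This is the brace law with \<open>x\<close> divided off on the left: each
  \<open>lam x\<close> is an endomorphism of the additive group.\<close>

lemma lam_add:
  "\<lbrakk>x \<in> carrier A; y \<in> carrier A; z \<in> carrier A\<rbrakk> \<Longrightarrow> lam x (y \<otimes> z) = lam x y \<otimes> lam x z"
  by (simp add: lam_def brace add.m_assoc)

text \<open>Left action of the circle group: expanding \<open>y\<close> circle \<open>z\<close> as
  \<open>y \<otimes> lam y z\<close> inside the triple product and applying the brace law leaves
  \<open>lam x (lam y z)\<close> as the last factor.\<close>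

lemma lam_circ:
  assumes "x \<in> carrier A" "y \<in> carrier A" "z \<in> carrier A"
  shows "lam (x \<otimes>\<^bsub>C\<^esub> y) z = lam x (lam y z)"
proof -
  have "(x \<otimes>\<^bsub>C\<^esub> y) \<otimes>\<^bsub>C\<^esub> z = (x \<otimes>\<^bsub>C\<^esub> y) \<otimes> lam x (lam y z)"
    using assms by (simp add: circ_assoc circ_eq[of y z] brace) (simp add: lam_def add.m_assoc)
  then show ?thesis
    using assms by (simp add: lam_def[of "x \<otimes>\<^bsub>C\<^esub> y"] flip: add.m_assoc)
qed

lemma lam_circ_rho:
  "\<lbrakk>x \<in> carrier A; y \<in> carrier A\<rbrakk> \<Longrightarrow> lam x y \<otimes>\<^bsub>C\<^esub> rho y x = x \<otimes>\<^bsub>C\<^esub> y"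
  by (simp add: rho_def carrier_eq circ.r_inv flip: circ_assoc)

text \<open>Left cancellation in \<open>C\<close>. It lets values of \<open>rho\<close> be found by
  checking a factorisation instead of computing a circle inverse.\<close>

lemma rho_unique:
  assumes "x \<in> carrier A" "y \<in> carrier A" "v \<in> carrier A"
    and "lam x y \<otimes>\<^bsub>C\<^esub> v = x \<otimes>\<^bsub>C\<^esub> y"
  shows "rho y x = v"
  using assms by (metis carrier_eq circ.l_cancel lam_circ_rho lam_closed rho_closed)

lemma lam_circ_right:
  assumes "x \<in> carrier A" "y \<in> carrier A" "z \<in> carrier A"
  shows "lam x (y \<otimes>\<^bsub>C\<^esub> z) = lam x y \<otimes>\<^bsub>C\<^esub> lam (rho y x) z"
  using assms by (simp add: circ_eq[of y z] circ_eq[of "lam x y"] lam_add lam_circ_rho flip: lam_circ)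

lemma rho_circ:
  assumes "x \<in> carrier A" "y \<in> carrier A" "z \<in> carrier A"
  shows "rho (y \<otimes>\<^bsub>C\<^esub> z) x = rho z (rho y x)"
proof (rule rho_unique)
  show "lam x (y \<otimes>\<^bsub>C\<^esub> z) \<otimes>\<^bsub>C\<^esub> rho z (rho y x) = x \<otimes>\<^bsub>C\<^esub> (y \<otimes>\<^bsub>C\<^esub> z)"
    using assms by (simp add: lam_circ_right circ_assoc lam_circ_rho)
      (simp add: lam_circ_rho flip: circ_assoc)
qed (use assms in auto)

lemma rho_one: "x \<in> carrier A \<Longrightarrow> rho \<one> x = x"
  by (rule rho_unique) (simp_all add: lam_one_right)

text \<open>An action of a group is by bijections; the circle inverse of \<open>x\<close> acts as
  the inverse map.\<close>

lemma bij_lam: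
  assumes "x \<in> carrier A"
  shows "bij_betw (lam x) (carrier A) (carrier A)"
  using assms
  by (intro bij_betw_byWitness[where f' = "lam (inv\<^bsub>C\<^esub> x)"])
    (auto simp: carrier_eq circ_one_eq lam_one_left simp flip: lam_circ)

lemma bij_rho:
  assumes "y \<in> carrier A"
  shows "bij_betw (rho y) (carrier A) (carrier A)"
  using assms
  by (intro bij_betw_byWitness[where f' = "rho (inv\<^bsub>C\<^esub> y)"])
    (auto simp: carrier_eq circ_one_eq rho_one simp flip: rho_circ)

text \<open>The outer components agree because \<open>lam\<close> and \<open>rho\<close> are actions
  and \<open>R\<close> preserves the circle product of a pair. Both sides then have the same triple
  circle product, so cancellation gives the middle component.\<close>

theorem YBE_solution_lam_rho:
  assumes R: "\<And>x y. \<lbrakk>x \<in> carrier A; y \<in> carrier A\<rbrakk> \<Longrightarrow> R (x, y) = (lam x y, rho y x)"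
  shows "YBE_solution (carrier A) R"
proof -
  have "(map_left R \<circ> map_right R \<circ> map_left R) (x, y, z) =
      (map_right R \<circ> map_left R \<circ> map_right R) (x, y, z)"
    if [simp]: "x \<in> carrier A" "y \<in> carrier A" "z \<in> carrier A" for x y z
  proof -
    \<comment> \<open>The left side passes through \<open>(lam x y, b, z)\<close> and
      \<open>(lam x y, c, d)\<close>, the right side through \<open>(x, p, q)\<close> and
      \<open>(lam x p, s, q)\<close>.\<close>
    define b where "b = rho y x"
    define p where "p = lam y z"
    define c d where "c = lam b z" and "d = rho z b"
    define q s where "q = rho z y" and "s = rho p x"
    have [simp]: "b \<in> carrier A" "p \<in> carrier A" "c \<in> carrier A" "d \<in> carrier A"
      "s \<in> carrier A" "q \<in> carrier A"
      by (simp_all add: b_def p_def c_def d_def s_def q_def)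
    have fst_eq: "lam (lam x y) c = lam x p"
      by (simp add: c_def p_def b_def lam_circ_rho flip: lam_circ)
    have trd_eq: "d = rho q s"
      by (simp add: d_def b_def s_def q_def p_def lam_circ_rho flip: rho_circ)
    \<comment> \<open>Both output triples multiply to \<open>x\<close> circle \<open>y\<close>
      circle \<open>z\<close>; their common outer factors are cancelled at the end of the
      chain.\<close>
    have "lam x p \<otimes>\<^bsub>C\<^esub> (rho c (lam x y) \<otimes>\<^bsub>C\<^esub> d) = lam x y \<otimes>\<^bsub>C\<^esub> (c \<otimes>\<^bsub>C\<^esub> d)"
      by (simp add: lam_circ_rho flip: fst_eq circ_assoc)
    also have "\<dots> = x \<otimes>\<^bsub>C\<^esub> y \<otimes>\<^bsub>C\<^esub> z"
      by (simp add: c_def d_def lam_circ_rho) (simp add: b_def lam_circ_rho flip: circ_assoc)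
    also have "\<dots> = x \<otimes>\<^bsub>C\<^esub> (p \<otimes>\<^bsub>C\<^esub> q)"
      by (simp add: p_def q_def lam_circ_rho circ_assoc)
    also have "\<dots> = lam x p \<otimes>\<^bsub>C\<^esub> (s \<otimes>\<^bsub>C\<^esub> q)"
      by (simp add: s_def lam_circ_rho flip: circ_assoc)
    also have "s \<otimes>\<^bsub>C\<^esub> q = lam s q \<otimes>\<^bsub>C\<^esub> d"
      by (simp add: trd_eq lam_circ_rho)
    finally have snd_eq: "rho c (lam x y) = lam s q"
      by (simp add: carrier_eq)
    show ?thesis
      using fst_eq snd_eq trd_eq
      by (simp add: map_left_def map_right_def R b_def c_def d_def p_def q_def s_def)
  qed
  moreover have "R \<in> carrier A \<times> carrier A \<rightarrow> carrier A \<times> carrier A"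
    by (auto simp: R)
  moreover have "bij_betw (\<lambda>y. fst (R (x, y))) (carrier A) (carrier A)" if "x \<in> carrier A" for x
    using bij_lam[OF that] that by (subst bij_betw_cong[where g = "lam x"]) (simp_all add: R)
  moreover have "bij_betw (\<lambda>x. snd (R (x, y))) (carrier A) (carrier A)" if "y \<in> carrier A" for y
    using bij_rho[OF that] that by (subst bij_betw_cong[where g = "rho y"]) (simp_all add: R)
  ultimately show ?thesis
    unfolding YBE_solution_def set_theoretic_YBE_solution_def non_degenerate_def by auto
qed

end

section \<open>Opposite additive group\<close>

definition opposite :: "('a, 'b) monoid_scheme \<Rightarrow> ('a, 'b) monoid_scheme" where
  "opposite G = G\<lparr>mult := \<lambda>x y. y \<otimes>\<^bsub>G\<^esub> x\<rparr>"

lemma opposite_simps [simp]: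
  "carrier (opposite G) = carrier G"
  "x \<otimes>\<^bsub>opposite G\<^esub> y = y \<otimes>\<^bsub>G\<^esub> x"
  "\<one>\<^bsub>opposite G\<^esub> = \<one>\<^bsub>G\<^esub>"
  by (simp_all add: opposite_def)

lemma (in group) group_opposite: "group (opposite G)"
  by (rule groupI) (auto simp: m_assoc intro: exI[of _ "inv _"] r_inv)

lemma (in group) inv_opposite: "x \<in> carrier G \<Longrightarrow> inv\<^bsub>opposite G\<^esub> x = inv x"
  by (rule group.inv_equality[OF group_opposite]) auto

text \<open>Reversing the additive product turns the brace law into itself with \<open>y\<close> and
  \<open>z\<close> exchanged.\<close>

lemma (in skew_brace) skew_brace_opposite: "skew_brace (opposite A) C"
proof -
  interpret opp: group "opposite A"
    by (rule add.group_opposite)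
  show ?thesis
    by unfold_locales (simp_all add: carrier_eq brace add.inv_opposite add.m_assoc)
qed

section \<open>Group laws twisted by a homomorphism with commuting values\<close>

definition circle :: "('a, 'b) monoid_scheme \<Rightarrow> ('a \<Rightarrow> 'a) \<Rightarrow> ('a, 'b) monoid_scheme" where
  "circle G \<phi> = G\<lparr>mult := \<lambda>g h. g \<otimes>\<^bsub>G\<^esub> inv\<^bsub>G\<^esub> \<phi> g \<otimes>\<^bsub>G\<^esub> h \<otimes>\<^bsub>G\<^esub> \<phi> g\<rparr>"

lemma circle_simps [simp]:
  "carrier (circle G \<phi>) = carrier G"
  "g \<otimes>\<^bsub>circle G \<phi>\<^esub> h = g \<otimes>\<^bsub>G\<^esub> inv\<^bsub>G\<^esub> \<phi> g \<otimes>\<^bsub>G\<^esub> h \<otimes>\<^bsub>G\<^esub> \<phi> g"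
  "\<one>\<^bsub>circle G \<phi>\<^esub> = \<one>\<^bsub>G\<^esub>"
  by (simp_all add: circle_def)

text \<open>Cancellation inside right-associated products, so that rewriting with
  \<open>m_assoc\<close> also simplifies words.\<close>

lemma (in group) inv_mult_cancel [simp]:
  "\<lbrakk>x \<in> carrier G; y \<in> carrier G\<rbrakk> \<Longrightarrow> inv x \<otimes> (x \<otimes> y) = y"
  "\<lbrakk>x \<in> carrier G; y \<in> carrier G\<rbrakk> \<Longrightarrow> x \<otimes> (inv x \<otimes> y) = y"
  by (simp_all flip: m_assoc)

text \<open>Conjugation is invisible to a homomorphism with commuting values. For
  \<open>a = \<phi> g\<close> this evaluates \<phi> on a twisted product; the reversed order on the
  right is the one in which the conjugators nest in the associativity law.\<close>

lemma (in group) hom_conj: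
  assumes "\<phi> \<in> hom G G"
    and "\<And>x y. \<lbrakk>x \<in> carrier G; y \<in> carrier G\<rbrakk> \<Longrightarrow> \<phi> x \<otimes> \<phi> y = \<phi> y \<otimes> \<phi> x"
    and "g \<in> carrier G" "h \<in> carrier G" "a \<in> carrier G"
  shows "\<phi> (g \<otimes> inv a \<otimes> h \<otimes> a) = \<phi> h \<otimes> \<phi> g"
proof -
  interpret \<phi>: group_hom G G \<phi>
    using assms(1) by unfold_locales
  have "\<phi> (g \<otimes> inv a \<otimes> h \<otimes> a) = \<phi> g \<otimes> (inv \<phi> a \<otimes> (\<phi> h \<otimes> \<phi> a))"
    using assms(3-) by (simp add: m_assoc)
  also have "\<dots> = \<phi> g \<otimes> \<phi> h"
    using assms(3-) by (simp add: assms(2)[of h a])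
  finally show ?thesis
    using assms(2-4) by simp
qed

lemma (in group) group_circle:
  assumes "\<phi> \<in> hom G G"
    and "\<And>x y. \<lbrakk>x \<in> carrier G; y \<in> carrier G\<rbrakk> \<Longrightarrow> \<phi> x \<otimes> \<phi> y = \<phi> y \<otimes> \<phi> x"
  shows "group (circle G \<phi>)"
proof -
  interpret \<phi>: group_hom G G \<phi>
    using assms(1) by unfold_locales
  show ?thesis
  proof (rule groupI)
    fix x
    assume "x \<in> carrier (circle G \<phi>)"
    \<comment> \<open>For a left inverse y of \<open>x\<close>, \<phi> y must be
      \<open>inv \<phi> x\<close>; solving the twisted equation with that value gives this
      witness.\<close>
    moreover from this have "\<phi> (\<phi> x \<otimes> inv x \<otimes> inv \<phi> x) = inv \<phi> x"
      using hom_conj[OF assms, of "\<one>" "inv x" "inv \<phi> x"] by simp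
    ultimately show "\<exists>y\<in>carrier (circle G \<phi>). y \<otimes>\<^bsub>circle G \<phi>\<^esub> x = \<one>\<^bsub>circle G \<phi>\<^esub>"
      by (intro bexI[of _ "\<phi> x \<otimes> inv x \<otimes> inv \<phi> x"])
        (simp_all del: \<phi>.hom_mult add: m_assoc)
  qed (simp_all del: \<phi>.hom_mult add: hom_conj[OF assms], simp_all add: m_assoc inv_mult_group)
qed

section \<open>The skew brace of two homomorphisms with commuting values\<close>

locale commuting_homs = group G for G (structure) +
  fixes \<alpha> \<beta> :: "'a \<Rightarrow> 'a"
  assumes hom_\<alpha>: "\<alpha> \<in> hom G G" and hom_\<beta>: "\<beta> \<in> hom G G"
    and comm_\<alpha>\<alpha>: "\<lbrakk>x \<in> carrier G; y \<in> carrier G\<rbrakk> \<Longrightarrow> \<alpha> x \<otimes> \<alpha> y = \<alpha> y \<otimes> \<alpha> x"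
    and comm_\<beta>\<beta>: "\<lbrakk>x \<in> carrier G; y \<in> carrier G\<rbrakk> \<Longrightarrow> \<beta> x \<otimes> \<beta> y = \<beta> y \<otimes> \<beta> x"
    and comm_\<alpha>\<beta>: "\<lbrakk>x \<in> carrier G; y \<in> carrier G\<rbrakk> \<Longrightarrow> \<alpha> x \<otimes> \<beta> y = \<beta> y \<otimes> \<alpha> x"
begin

sublocale \<alpha>: group_hom G G \<alpha>
  using hom_\<alpha> by unfold_locales

sublocale \<beta>: group_hom G G \<beta>
  using hom_\<beta> by unfold_locales

lemma inv_circle:
  assumes "g \<in> carrier G"
  shows "inv\<^bsub>circle G \<alpha>\<^esub> g = \<alpha> g \<otimes> inv g \<otimes> inv \<alpha> g"
  using assms hom_conj[OF hom_\<alpha> comm_\<alpha>\<alpha>, of "\<one>" "inv g" "inv \<alpha> g"]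
  by (intro group.inv_equality[OF group_circle[OF hom_\<alpha> comm_\<alpha>\<alpha>]])
    (simp_all add: m_assoc)

text \<open>\<alpha> sends the twisted inverse of \<open>g\<close> to \<open>inv \<alpha> g\<close>,
  so the inner factors cancel. This is the shape of \<open>lam\<close>.\<close>

lemma circle_left_quotient:
  assumes "g \<in> carrier G" "h \<in> carrier G"
  shows "inv\<^bsub>circle G \<alpha>\<^esub> g \<otimes>\<^bsub>circle G \<alpha>\<^esub> h = \<alpha> g \<otimes> inv g \<otimes> h \<otimes> inv \<alpha> g"
  using assms hom_conj[OF hom_\<alpha> comm_\<alpha>\<alpha>, of "\<one>" "inv g" "inv \<alpha> g"]
  by (simp add: inv_circle) (simp add: m_assoc)

lemma skew_brace_circle: "skew_brace (circle G \<alpha>) (circle G \<beta>)"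
proof -
  interpret A: group "circle G \<alpha>"
    by (rule group_circle[OF hom_\<alpha> comm_\<alpha>\<alpha>])
  interpret B: group "circle G \<beta>"
    by (rule group_circle[OF hom_\<beta> comm_\<beta>\<beta>])
  show ?thesis
  proof unfold_locales
    fix x y z
    assume "x \<in> carrier (circle G \<alpha>)" "y \<in> carrier (circle G \<alpha>)" "z \<in> carrier (circle G \<alpha>)"
    then have [simp]: "x \<in> carrier G" "y \<in> carrier G" "z \<in> carrier G"
      by simp_all
    \<comment> \<open>\<open>lam x\<close> will be conjugation by \<open>c\<close>. As a product of
      values of \<alpha> and \<beta>, \<open>c\<close> commutes with \<open>\<alpha> y\<close>,
      which is what the brace law rests on.\<close>
    define c where "c = \<alpha> x \<otimes> inv \<beta> x"
    have [simp]: "c \<in> carrier G"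
      by (simp add: c_def)
    have c: "c \<otimes> \<alpha> y = \<alpha> y \<otimes> c"
    proof -
      have "inv \<beta> x \<otimes> \<alpha> y = \<alpha> y \<otimes> inv \<beta> x"
        using comm_\<alpha>\<beta>[of y "inv x"] by simp
      then have "c \<otimes> \<alpha> y = (\<alpha> x \<otimes> \<alpha> y) \<otimes> inv \<beta> x"
        by (simp add: c_def m_assoc)
      then show ?thesis
        by (simp add: c_def m_assoc comm_\<alpha>\<alpha>[of x y])
    qed
    define w where "w = inv\<^bsub>circle G \<alpha>\<^esub> x \<otimes>\<^bsub>circle G \<alpha>\<^esub> (x \<otimes>\<^bsub>circle G \<beta>\<^esub> z)"
    have w: "w = c \<otimes> z \<otimes> inv c"
      unfolding w_def by (subst circle_left_quotient) (simp_all add: c_def m_assoc inv_mult_group)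
    \<comment> \<open>By \<open>hom_conj\<close>, \<alpha> maps the \<beta>-twisted product of
      \<open>x\<close> and \<open>y\<close> to
      \<open>\<alpha> y \<otimes> \<alpha> x\<close>.\<close>
    have "x \<otimes>\<^bsub>circle G \<beta>\<^esub> y \<otimes>\<^bsub>circle G \<alpha>\<^esub> w =
        x \<otimes> inv \<beta> x \<otimes> y \<otimes> \<beta> x \<otimes> inv (\<alpha> y \<otimes> \<alpha> x) \<otimes> w \<otimes> (\<alpha> y \<otimes> \<alpha> x)"
      by (simp del: \<alpha>.hom_mult add: hom_conj[OF hom_\<alpha> comm_\<alpha>\<alpha>])
    also have "\<dots> = x \<otimes> inv \<beta> x \<otimes> y \<otimes> \<beta> x \<otimes> inv \<alpha> x \<otimes> (inv \<alpha> y \<otimes> c) \<otimes> z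
        \<otimes> inv (inv \<alpha> y \<otimes> c) \<otimes> \<alpha> x"
      by (simp add: w m_assoc inv_mult_group)
    also have "inv \<alpha> y \<otimes> c = c \<otimes> inv \<alpha> y"
      using c by (metis \<open>c \<in> carrier G\<close> \<open>y \<in> carrier G\<close> \<alpha>.hom_closed inv_solve_left
          inv_solve_right m_assoc m_closed inv_closed)
    \<comment> \<open>With \<open>c\<close> moved to the front, it meets
      \<open>\<beta> x \<otimes> inv \<alpha> x\<close>, its own inverse.\<close>
    also have "x \<otimes> inv \<beta> x \<otimes> y \<otimes> \<beta> x \<otimes> inv \<alpha> x \<otimes> (c \<otimes> inv \<alpha> y) \<otimes> z \<otimes> inv (c \<otimes> inv \<alpha> y) \<otimes> \<alpha> x
        = x \<otimes> inv \<beta> x \<otimes> y \<otimes> (\<beta> x \<otimes> inv \<alpha> x \<otimes> \<alpha> x \<otimes> inv \<beta> x) \<otimes> inv \<alpha> y \<otimes> z \<otimes> \<alpha> y \<otimes> \<beta> x"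
      by (simp add: c_def m_assoc inv_mult_group)
    also have "\<dots> = x \<otimes>\<^bsub>circle G \<beta>\<^esub> (y \<otimes>\<^bsub>circle G \<alpha>\<^esub> z)"
      by (simp add: m_assoc)
    finally show "x \<otimes>\<^bsub>circle G \<beta>\<^esub> (y \<otimes>\<^bsub>circle G \<alpha>\<^esub> z) =
        x \<otimes>\<^bsub>circle G \<beta>\<^esub> y \<otimes>\<^bsub>circle G \<alpha>\<^esub> inv\<^bsub>circle G \<alpha>\<^esub> x \<otimes>\<^bsub>circle G \<alpha>\<^esub> (x \<otimes>\<^bsub>circle G \<beta>\<^esub> z)"
      using A.m_assoc A.inv_closed B.m_closed by (simp add: w_def del: circle_simps(2))
  qed simp
qed

lemma YBE_solution_circle:
  "YBE_solution (carrier G) (\<lambda>(g, h).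
    (\<alpha> g \<otimes> \<beta> (inv g) \<otimes> h \<otimes> \<beta> g \<otimes> \<alpha> (inv g),
     \<alpha> g \<otimes> \<beta> (inv g \<otimes> h) \<otimes> inv h \<otimes> \<beta> g \<otimes> \<alpha> (inv g) \<otimes> g \<otimes> \<beta> (inv g) \<otimes> h \<otimes> \<beta> (g \<otimes> inv h)))"
  (is "YBE_solution _ ?R")
proof -
  interpret B: skew_brace "circle G \<alpha>" "circle G \<beta>"
    by (rule skew_brace_circle)
  have "?R (x, y) = (B.lam x y, B.rho y x)" if [simp]: "x \<in> carrier G" "y \<in> carrier G" for x y
  proof -
    have lam: "B.lam x y = \<alpha> x \<otimes> inv \<beta> x \<otimes> y \<otimes> \<beta> x \<otimes> inv \<alpha> x"
      unfolding B.lam_def by (subst circle_left_quotient) (simp_all add: m_assoc)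
    \<comment> \<open>The leading \<one> brings the conjugate of \<open>y\<close> into the form
      required by \<open>hom_conj\<close>, hence \<beta> takes the same value on it as on
      \<open>y\<close>.\<close>
    have lam': "B.lam x y = \<one> \<otimes> inv (\<beta> x \<otimes> inv \<alpha> x) \<otimes> y \<otimes> (\<beta> x \<otimes> inv \<alpha> x)"
      by (simp add: lam m_assoc inv_mult_group)
    have \<beta>_lam: "\<beta> (B.lam x y) = \<beta> y"
      by (subst lam', subst hom_conj[OF hom_\<beta> comm_\<beta>\<beta>]) simp_all
    \<comment> \<open>Since \<beta> of \<open>B.lam x y\<close> is \<open>\<beta> y\<close>, the
      factorisation defining \<open>rho\<close> can be solved explicitly.\<close>
    have "B.rho y x = \<beta> y \<otimes> inv (B.lam x y) \<otimes> (x \<otimes> inv \<beta> x \<otimes> y \<otimes> \<beta> x) \<otimes> inv \<beta> y"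
    proof (rule B.rho_unique)
      have "\<beta> y \<otimes> inv (B.lam x y) \<in> carrier G"
        using B.lam_closed by simp
      then show "B.lam x y \<otimes>\<^bsub>circle G \<beta>\<^esub>
          (\<beta> y \<otimes> inv (B.lam x y) \<otimes> (x \<otimes> inv \<beta> x \<otimes> y \<otimes> \<beta> x) \<otimes> inv \<beta> y) = x \<otimes>\<^bsub>circle G \<beta>\<^esub> y"
        using B.lam_closed[of x y] by (simp add: \<beta>_lam m_assoc)
    qed (use B.lam_closed in auto)
    also have "\<dots> = (\<beta> y \<otimes> \<alpha> x) \<otimes> inv \<beta> x \<otimes> inv y \<otimes> \<beta> x \<otimes> inv \<alpha> x \<otimes> x \<otimes> inv \<beta> x \<otimes> y \<otimes> \<beta> x \<otimes> inv \<beta> y"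
      by (simp add: lam m_assoc inv_mult_group)
    \<comment> \<open>Moving \<open>\<beta> y\<close> past \<open>\<alpha> x\<close> lets it merge
      with \<open>\<beta> (inv x)\<close> into the stated
      \<open>\<beta> (inv x \<otimes> y)\<close>.\<close>
    also have "\<dots> = \<alpha> x \<otimes> (\<beta> y \<otimes> \<beta> (inv x)) \<otimes> inv y \<otimes> \<beta> x \<otimes> inv \<alpha> x \<otimes> x \<otimes> inv \<beta> x \<otimes> y \<otimes> \<beta> x \<otimes> inv \<beta> y"
      by (subst comm_\<alpha>\<beta>[of x y, symmetric]) (simp_all add: m_assoc)
    also have "\<beta> y \<otimes> \<beta> (inv x) = \<beta> (inv x \<otimes> y)"
      using comm_\<beta>\<beta>[of y "inv x"] by simp
    finally show ?thesis
      by (simp add: lam m_assoc)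
  qed
  then show ?thesis
    using B.YBE_solution_lam_rho by simp
qed

lemma YBE_solution_opposite_circle:
  "YBE_solution (carrier G) (\<lambda>(g, h).
    (g \<otimes> \<beta> (inv g) \<otimes> h \<otimes> \<beta> g \<otimes> \<alpha> (inv h) \<otimes> inv g \<otimes> \<alpha> h,
     \<beta> h \<otimes> \<alpha> (inv h) \<otimes> g \<otimes> \<alpha> h \<otimes> \<beta> (inv h)))"
  (is "YBE_solution _ ?R")
proof -
  interpret A: group "circle G \<alpha>"
    by (rule group_circle[OF hom_\<alpha> comm_\<alpha>\<alpha>])
  interpret B: skew_brace "opposite (circle G \<alpha>)" "circle G \<beta>"
    by (intro skew_brace.skew_brace_opposite skew_brace_circle)
  have "?R (x, y) = (B.lam x y, B.rho y x)" if [simp]: "x \<in> carrier G" "y \<in> carrier G" for x y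
  proof -
    \<comment> \<open>In the opposite group \<open>lam\<close> divides by \<open>x\<close> on the
      right, so the twist comes from \<alpha> of the circle product,
      \<open>\<alpha> y \<otimes> \<alpha> x\<close>.\<close>
    have "B.lam x y = x \<otimes> inv \<beta> x \<otimes> y \<otimes> \<beta> x \<otimes> inv (\<alpha> y \<otimes> \<alpha> x) \<otimes> (\<alpha> x \<otimes> inv x \<otimes> inv \<alpha> x) \<otimes> (\<alpha> x \<otimes> \<alpha> y)"
      by (simp del: \<alpha>.hom_mult add: B.lam_def A.inv_opposite inv_circle
          hom_conj[OF hom_\<alpha> comm_\<alpha>\<alpha>] comm_\<alpha>\<alpha>[of x y])
    also have "\<dots> = x \<otimes> inv \<beta> x \<otimes> y \<otimes> \<beta> x \<otimes> inv (\<alpha> x \<otimes> \<alpha> y) \<otimes> (\<alpha> x \<otimes> inv x \<otimes> inv \<alpha> x) \<otimes> (\<alpha> x \<otimes> \<alpha> y)"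
      by (simp only: comm_\<alpha>\<alpha>[of x y] that)
    finally have lam: "B.lam x y = x \<otimes> inv \<beta> x \<otimes> y \<otimes> \<beta> x \<otimes> inv \<alpha> y \<otimes> inv x \<otimes> \<alpha> y"
      by (simp add: m_assoc inv_mult_group)
    \<comment> \<open>\<open>hom_conj\<close> is applied twice: first to the trailing conjugate of
      \<open>inv x\<close>, then to the conjugate of \<open>y\<close>.\<close>
    have "\<beta> (B.lam x y) = \<beta> (inv x) \<otimes> \<beta> (x \<otimes> inv \<beta> x \<otimes> y \<otimes> \<beta> x)"
      unfolding lam by (subst hom_conj[OF hom_\<beta> comm_\<beta>\<beta>]) simp_all
    also have "\<dots> = \<beta> (inv x) \<otimes> (\<beta> y \<otimes> \<beta> x)"
      by (subst hom_conj[OF hom_\<beta> comm_\<beta>\<beta>]) simp_all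
    also have "\<dots> = \<beta> y"
      by (simp add: comm_\<beta>\<beta>[of y x])
    finally have \<beta>_lam: "\<beta> (B.lam x y) = \<beta> y" .
    \<comment> \<open>\<open>lam\<close> is the circle product times the inverse of \<open>x\<close>
      conjugated by \<open>\<alpha> y\<close>; \<open>rho\<close> restores that conjugate, and its
      outer \<beta> factors undo the twist by \<open>\<beta> y\<close>.\<close>
    have "B.rho y x = \<beta> y \<otimes> inv \<alpha> y \<otimes> x \<otimes> \<alpha> y \<otimes> inv \<beta> y"
      by (rule B.rho_unique) (simp_all add: \<beta>_lam, simp add: lam m_assoc)
    then show ?thesis
      by (simp add: lam)
  qed
  then show ?thesis
    using B.YBE_solution_lam_rho by simp
qed

end

section \<open>The maps \<open>psi_iter\<close> as endomorphisms with image in that of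
  \<psi>\<close>

lemma (in group) map_diff_id_funpow_closed:
  assumes "\<psi> \<in> hom G G" "g \<in> carrier G"
  shows "((map_diff G id \<psi>) ^^ n) g \<in> carrier G"
proof -
  interpret group_hom G G \<psi>
    using assms(1) by unfold_locales
  show ?thesis
    using assms(2) by (induction n) (simp_all add: map_diff_def map_add_def map_neg_def)
qed

lemma (in group) psi_iter_0: "g \<in> carrier G \<Longrightarrow> psi_iter G \<psi> 0 g = \<one>"
  by (simp add: psi_iter_def map_add_def map_neg_def l_inv)

text \<open>The n-th iterate of 1 - \<psi> at \<open>g\<close> is d =
  \<open>g \<otimes> inv psi_iter G \<psi> n g\<close>; one more iteration replaces it by
  \<open>d \<otimes> inv \<psi> d\<close>, whose inverse contributes the new factor
  \<open>\<psi> d\<close>.\<close>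

lemma (in group) psi_iter_Suc:
  assumes "\<psi> \<in> hom G G" "g \<in> carrier G"
  shows "psi_iter G \<psi> (Suc n) g =
    \<psi> (g \<otimes> inv psi_iter G \<psi> n g) \<otimes> psi_iter G \<psi> n g"
proof -
  interpret group_hom G G \<psi>
    using assms(1) by unfold_locales
  define d where "d = ((map_diff G id \<psi>) ^^ n) g"
  have d: "d \<in> carrier G"
    unfolding d_def by (rule map_diff_id_funpow_closed[OF assms])
  have p: "psi_iter G \<psi> n g = inv d \<otimes> g"
    by (simp add: psi_iter_def map_add_def map_neg_def d_def)
  have "psi_iter G \<psi> (Suc n) g = inv (d \<otimes> inv \<psi> d) \<otimes> g"
    by (simp add: psi_iter_def map_add_def map_neg_def map_diff_def d_def)
  also have "\<dots> = \<psi> d \<otimes> (inv d \<otimes> g)"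
    using d assms(2) by (simp add: inv_mult_group m_assoc)
  also have "d = g \<otimes> inv (inv d \<otimes> g)"
    using d assms(2) by (simp add: inv_mult_group)
  finally show ?thesis
    using d assms(2) by (simp add: p inv_mult_group)
qed

text \<open>Both claims go through one induction: multiplicativity at the next stage requires values
  of the current map to commute with values of \<psi>.\<close>

lemma (in group) psi_iter_abelian:
  assumes "\<psi> \<in> abelian_maps G"
  shows "psi_iter G \<psi> n \<in> hom G G \<and> psi_iter G \<psi> n ` carrier G \<subseteq> \<psi> ` carrier G"
proof -
  have hom: "\<psi> \<in> hom G G"
    using assms by (simp add: abelian_maps_def)
  interpret group_hom G G \<psi>
    using hom by unfold_locales
  interpret I: comm_group "G\<lparr>carrier := \<psi> ` carrier G\<rparr>"
    using assms by (simp add: abelian_maps_def)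
  have comm: "a \<otimes> b = b \<otimes> a" if "a \<in> \<psi> ` carrier G" "b \<in> \<psi> ` carrier G" for a b
    using I.m_comm that by simp
  have img: "a \<otimes> b \<in> \<psi> ` carrier G" if "a \<in> \<psi> ` carrier G" "b \<in> \<psi> ` carrier G" for a b
    using I.m_closed that by simp
  show ?thesis
  proof (induction n)
    case 0
    then show ?case
      using I.one_closed by (auto simp: hom_def psi_iter_0)
  next
    case (Suc n)
    let ?p = "psi_iter G \<psi> n"
    interpret p: group_hom G G ?p
      using Suc by unfold_locales simp
    have p: "?p x \<in> \<psi> ` carrier G" if "x \<in> carrier G" for x
      using Suc that by blast
    have "psi_iter G \<psi> (Suc n) (x \<otimes> y) = psi_iter G \<psi> (Suc n) x \<otimes> psi_iter G \<psi> (Suc n) y"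
      if [simp]: "x \<in> carrier G" "y \<in> carrier G" for x y
    proof -
      let ?u = "x \<otimes> inv ?p x" and ?v = "y \<otimes> inv ?p y"
      have "psi_iter G \<psi> (Suc n) (x \<otimes> y) =
          \<psi> x \<otimes> (\<psi> ?v \<otimes> inv \<psi> (?p x)) \<otimes> (?p x \<otimes> ?p y)"
        by (simp add: psi_iter_Suc hom inv_mult_group m_assoc)
      \<comment> \<open>Two exchanges inside the abelian image separate the factors: this one
        completes \<open>\<psi> ?u\<close>, the later one moves \<open>?p x\<close> next to
        it.\<close>
      also have "\<psi> ?v \<otimes> inv \<psi> (?p x) = inv \<psi> (?p x) \<otimes> \<psi> ?v"
        using comm[OF imageI imageI, of ?v "inv ?p x"] by simp
      also have "\<psi> x \<otimes> (inv \<psi> (?p x) \<otimes> \<psi> ?v) \<otimes> (?p x \<otimes> ?p y) = \<psi> ?u \<otimes> (\<psi> ?v \<otimes> ?p x) \<otimes> ?p y"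
        by (simp add: m_assoc)
      also have "\<psi> ?v \<otimes> ?p x = ?p x \<otimes> \<psi> ?v"
        by (intro comm p imageI) simp_all
      finally show ?thesis
        by (simp add: psi_iter_Suc hom m_assoc)
    qed
    moreover have "psi_iter G \<psi> (Suc n) x \<in> \<psi> ` carrier G" if "x \<in> carrier G" for x
      using that p by (auto simp: psi_iter_Suc hom simp del: hom_mult intro!: img)
    moreover have "\<psi> ` carrier G \<subseteq> carrier G"
      by auto
    ultimately show ?case
      unfolding hom_def by blast
  qed
qed

theorem theorem4p15:
  fixes G :: "('a, 'b) monoid_scheme" (structure) and \<psi> :: "'a \<Rightarrow> 'a" and m n :: nat
  assumes "group G" and "finite (carrier G)" and "\<not> comm_group G"
    and "\<psi> \<in> abelian_maps G"
  shows "let \<psi>\<^sub>m = psi_iter G \<psi> m; \<psi>\<^sub>n = psi_iter G \<psi> n in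
      YBE_solution (carrier G) (\<lambda>(g, h).
        (\<psi>\<^sub>m g \<otimes> \<psi>\<^sub>n (inv g) \<otimes> h \<otimes> \<psi>\<^sub>n g \<otimes> \<psi>\<^sub>m (inv g),
         \<psi>\<^sub>m g \<otimes> \<psi>\<^sub>n (inv g \<otimes> h) \<otimes> inv h \<otimes> \<psi>\<^sub>n g \<otimes> \<psi>\<^sub>m (inv g) \<otimes> g
           \<otimes> \<psi>\<^sub>n (inv g) \<otimes> h \<otimes> \<psi>\<^sub>n (g \<otimes> inv h))) \<and>
      YBE_solution (carrier G) (\<lambda>(g, h).
        (g \<otimes> \<psi>\<^sub>n (inv g) \<otimes> h \<otimes> \<psi>\<^sub>n g \<otimes> \<psi>\<^sub>m (inv h) \<otimes> inv g \<otimes> \<psi>\<^sub>m h,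
         \<psi>\<^sub>n h \<otimes> \<psi>\<^sub>m (inv h) \<otimes> g \<otimes> \<psi>\<^sub>m h \<otimes> \<psi>\<^sub>n (inv h)))"
proof -
  interpret group G by fact
  interpret I: comm_group "G\<lparr>carrier := \<psi> ` carrier G\<rparr>"
    using assms(4) by (simp add: abelian_maps_def)
  have img: "psi_iter G \<psi> k x \<in> \<psi> ` carrier G" if "x \<in> carrier G" for k x
    using psi_iter_abelian[OF assms(4), of k] that by blast
  \<comment> \<open>All three commutation conditions hold because both maps take values in the one
    abelian group \<psi>(G).\<close>
  interpret commuting_homs G "psi_iter G \<psi> m" "psi_iter G \<psi> n"
    using psi_iter_abelian[OF assms(4)] I.m_comm img
    by unfold_locales simp_all
  show ?thesis
    unfolding Let_def using YBE_solution_circle YBE_solution_opposite_circle by blast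
qed

end
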